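(* Let $f\in H^\uparrow$. If $\mathrm{card}(S_f)>1$, then $\mathrm{card}(S_f)=\mathfrak{c}$.
   Context: $\omega=\{0,1,2,\ldots\}$ and $n\in\omega$ is identified with $\{0,\ldots,n-1\}$. $G$ is the set of all functions $g\colon\omega\to(0,\infty)$ such that $g(n)\to\infty$ and $\frac{n}{g(n)}\not\to 0$. For $g\in G$, $\mathcal{Z}_g=\{A\subseteq\omega:\ \lim_{n\to\infty}\frac{\mathrm{card}(A\cap n)}{g(n)}=0\}$. $H^\uparrow$ is the set of all nondecreasing $g\in G$ with values in $\omega$. For $f\in H^\uparrow$, $S_f=\{g\in H^\uparrow:\ \mathcal{Z}_f=\mathcal{Z}_g\}/R$ is the set of equivalence classes of the equivalence relation $R$ given by $gRh\iff\limsup_{n\to\infty}\frac{g(n)}{h(n)}<\infty$ and $\limsup_{n\to\infty}\frac{h(n)}{g(n)}<\infty$. $\mathfrak{c}$ is the cardinality of the continuum. *)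

theory Defs
  imports Complex_Main "HOL-Library.Equipollence" "HOL-Library.Extended_Real"
begin

definition G_set :: "(nat \<Rightarrow> real) set" where
  "G_set = {g. (\<forall>n. 0 < g n) \<and> filterlim g at_top sequentially
              \<and> \<not> ((\<lambda>n. real n / g n) \<longlonglongrightarrow> 0)}"

definition Z_ideal :: "(nat \<Rightarrow> real) \<Rightarrow> nat set set" where
  "Z_ideal g = {A. (\<lambda>n. real (card (A \<inter> {..<n})) / g n) \<longlonglongrightarrow> 0}"

definition H_up :: "(nat \<Rightarrow> real) set" where
  "H_up = {g \<in> G_set. mono g \<and> (\<forall>n. g n \<in> \<nat>)}"

definition H_up_same_ideal :: "(nat \<Rightarrow> real) \<Rightarrow> (nat \<Rightarrow> real) set" where
  "H_up_same_ideal f = {g \<in> H_up. Z_ideal f = Z_ideal g}"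

text \<open>The limits superior are taken in the extended reals, so that \<open>< \<infinity>\<close> is a
  genuine condition.\<close>

definition same_growth :: "(nat \<Rightarrow> real) \<Rightarrow> (nat \<Rightarrow> real) \<Rightarrow> bool" where
  "same_growth g h \<longleftrightarrow>
     limsup (\<lambda>n. ereal (g n / h n)) < \<infinity> \<and> limsup (\<lambda>n. ereal (h n / g n)) < \<infinity>"

definition R_on :: "(nat \<Rightarrow> real) set \<Rightarrow> ((nat \<Rightarrow> real) \<times> (nat \<Rightarrow> real)) set" where
  "R_on X = {(g, h). g \<in> X \<and> h \<in> X \<and> same_growth g h}"

definition S_classes :: "(nat \<Rightarrow> real) \<Rightarrow> (nat \<Rightarrow> real) set set" where
  "S_classes f = H_up_same_ideal f // R_on (H_up_same_ideal f)"

lemma limsup_ereal_less_top_iff: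
  "limsup (\<lambda>n. ereal (u n)) < \<infinity> \<longleftrightarrow> (\<exists>C. eventually (\<lambda>n. u n \<le> C) sequentially)"
proof
  assume "limsup (\<lambda>n. ereal (u n)) < \<infinity>"
  then obtain c :: ereal where c: "limsup (\<lambda>n. ereal (u n)) < c" "c < \<infinity>"
    using dense by blast
  then obtain C where C: "c = ereal C"
    by (cases c) auto
  have "eventually (\<lambda>n. ereal (u n) < c) sequentially"
    by (rule Limsup_lessD[OF c(1)])
  then have "eventually (\<lambda>n. u n \<le> C) sequentially"
    by (rule eventually_mono) (simp add: C)
  then show "\<exists>C. eventually (\<lambda>n. u n \<le> C) sequentially" ..
next
  assume "\<exists>C. eventually (\<lambda>n. u n \<le> C) sequentially"
  then obtain C where "eventually (\<lambda>n. u n \<le> C) sequentially" ..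
  then have "limsup (\<lambda>n. ereal (u n)) \<le> ereal C"
    by (intro Limsup_bounded) (auto elim: eventually_mono)
  then show "limsup (\<lambda>n. ereal (u n)) < \<infinity>"
    by (rule order.strict_trans1) simp
qed

lemma limsup_quotient_trans:
  fixes f g h :: "nat \<Rightarrow> real"
  assumes pos: "\<And>n. 0 < f n" "\<And>n. 0 < g n" "\<And>n. 0 < h n"
    and fg: "limsup (\<lambda>n. ereal (f n / g n)) < \<infinity>"
    and gh: "limsup (\<lambda>n. ereal (g n / h n)) < \<infinity>"
  shows "limsup (\<lambda>n. ereal (f n / h n)) < \<infinity>"
proof -
  obtain C D where "eventually (\<lambda>n. f n / g n \<le> C) sequentially"
      "eventually (\<lambda>n. g n / h n \<le> D) sequentially"
    using fg gh unfolding limsup_ereal_less_top_iff by blast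
  then have "eventually (\<lambda>n. f n / h n \<le> C * D) sequentially"
  proof eventually_elim
    case (elim n)
    have "f n / g n * (g n / h n) \<le> C * D"
    proof (rule mult_mono[OF elim])
      have "0 < f n / g n" using pos by simp
      then show "0 \<le> C" using elim(1) by linarith
      show "0 \<le> g n / h n" using pos(2,3)[of n] by simp
    qed
    moreover have "f n / g n * (g n / h n) = f n / h n"
      using pos(2)[of n] by simp
    ultimately show ?case by metis
  qed
  then show ?thesis unfolding limsup_ereal_less_top_iff by blast
qed

lemma equiv_R_on:
  assumes "X \<subseteq> G_set"
  shows "equiv X (R_on X)"
proof (rule equivI)
  have pos: "0 < g n" if "g \<in> X" for g n
    using that assms unfolding G_set_def by blast
  show "R_on X \<subseteq> X \<times> X" by (auto simp: R_on_def)
  show "refl_on X (R_on X)"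
  proof (rule refl_onI)
    fix g assume g: "g \<in> X"
    have "(\<lambda>n. g n / g n) = (\<lambda>_. 1)" using pos[OF g] by (simp add: less_imp_neq[symmetric])
    then have "limsup (\<lambda>n. ereal (g n / g n)) < \<infinity>"
      unfolding limsup_ereal_less_top_iff by (metis (lifting) eventually_sequentiallyI order_refl)
    then show "(g, g) \<in> R_on X" using g by (simp add: R_on_def same_growth_def)
  qed
  show "sym (R_on X)" by (auto simp: sym_def R_on_def same_growth_def)
  show "trans (R_on X)"
    using limsup_quotient_trans pos
    unfolding trans_def R_on_def same_growth_def by blast
qed

end

theory Submission
  imports Defs "HOL-Analysis.Abstract_Topology_2"
begin

text \<open>
  If \<open>h \<le> g\<close> generate the same ideal, then so does every nondecreasing integer-valued \<open>k\<close>
  with \<open>h \<le> k \<le> g\<close>. Two inequivalent functions \<open>g\<close>, \<open>h\<close> with the same ideal can be arranged to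
  satisfy \<open>h \<le> g\<close>, by passing from \<open>h\<close> to \<open>min g h\<close>, with \<open>g / h\<close> unbounded. Choose a sparse
  sequence \<open>N i\<close> with \<open>g (N i) > i * h (N i)\<close> and \<open>g (N i) \<le> h (N (i + 1))\<close>. For a set \<open>X\<close> of
  indices the least nondecreasing function that is \<open>\<ge> h\<close>, and \<open>\<ge> g\<close> at the points \<open>N i\<close> with
  \<open>i \<in> X\<close>, equals \<open>g\<close> at these points and equals \<open>h\<close> at the other \<open>N i\<close>. Hence \<open>X\<close> and \<open>Y\<close> give
  inequivalent functions whenever their symmetric difference is infinite, and there are
  continuum many sets of indices that pairwise differ infinitely often.
\<close>

section \<open>Passing to smaller functions in \<open>H_up\<close>, and the ideals\<close>

lemma H_upD:
  assumes "g \<in> H_up"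
  shows "0 < g n" "filterlim g at_top sequentially" "\<not> (\<lambda>n. real n / g n) \<longlonglongrightarrow> 0"
    "mono g" "g n \<in> \<nat>"
  using assms by (auto simp: H_up_def G_set_def)

text \<open>Shrinking \<open>g\<close> only enlarges \<open>n / g n\<close>, so the failure of this
  quotient to tend to 0 passes from \<open>g\<close> down to \<open>k\<close>. Divergence to
  infinity does not pass down and has to be assumed.\<close>

lemma H_up_below:
  assumes g: "g \<in> H_up" and pos: "\<And>n. 0 < k n" and le: "\<And>n. k n \<le> g n"
    and "filterlim k at_top sequentially" "mono k" "\<And>n. k n \<in> \<nat>"
  shows "k \<in> H_up"
proof -
  have "\<not> (\<lambda>n. real n / k n) \<longlonglongrightarrow> 0"
  proof
    assume "(\<lambda>n. real n / k n) \<longlonglongrightarrow> 0"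
    then have "(\<lambda>n. real n / g n) \<longlonglongrightarrow> 0"
    proof (rule tendsto_sandwich[OF _ _ tendsto_const, rotated 2])
      show "\<forall>\<^sub>F n in sequentially. 0 \<le> real n / g n"
        using H_upD(1)[OF g] by (simp add: less_imp_le)
      show "\<forall>\<^sub>F n in sequentially. real n / g n \<le> real n / k n"
        using pos le H_upD(1)[OF g] by (intro always_eventually allI divide_left_mono) auto
    qed
    then show False using H_upD(3)[OF g] by blast
  qed
  then show ?thesis using assms by (simp add: H_up_def G_set_def)
qed

lemma H_up_min:
  assumes "g \<in> H_up" "h \<in> H_up"
  shows "(\<lambda>n. min (g n) (h n)) \<in> H_up"
proof (rule H_up_below[OF assms(1)])
  show "filterlim (\<lambda>n. min (g n) (h n)) at_top sequentially"
    using H_upD(2)[OF assms(1)] H_upD(2)[OF assms(2)]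
    unfolding filterlim_at_top by (auto intro: eventually_conj)
  show "mono (\<lambda>n. min (g n) (h n))"
    using H_upD(4)[OF assms(1)] H_upD(4)[OF assms(2)]
    unfolding mono_def by (meson min.mono)
qed (use H_upD[OF assms(1)] H_upD[OF assms(2)] in \<open>auto simp: min_def\<close>)

lemma Z_ideal_mono:
  assumes "\<And>n. 0 < g n" "\<And>n. g n \<le> h n"
  shows "Z_ideal g \<subseteq> Z_ideal h"
proof
  fix A assume "A \<in> Z_ideal g"
  then have "(\<lambda>n. real (card (A \<inter> {..<n})) / g n) \<longlonglongrightarrow> 0" by (simp add: Z_ideal_def)
  then have "(\<lambda>n. real (card (A \<inter> {..<n})) / h n) \<longlonglongrightarrow> 0"
  proof (rule tendsto_sandwich[OF _ _ tendsto_const, rotated 2])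
    have hpos: "0 < h n" for n using assms order_less_le_trans by blast
    show "\<forall>\<^sub>F n in sequentially. 0 \<le> real (card (A \<inter> {..<n})) / h n"
      using hpos by (simp add: less_imp_le)
    show "\<forall>\<^sub>F n in sequentially. real (card (A \<inter> {..<n})) / h n \<le> real (card (A \<inter> {..<n})) / g n"
      using assms hpos by (intro always_eventually allI divide_left_mono) auto
  qed
  then show "A \<in> Z_ideal h" by (simp add: Z_ideal_def)
qed

text \<open>Dividing by the minimum gives the larger of the two quotients, and the maximum of two
  null sequences is null.\<close>

lemma Z_ideal_min:
  assumes "\<And>n. 0 < g n" "\<And>n. 0 < h n"
  shows "Z_ideal (\<lambda>n. min (g n) (h n)) = Z_ideal g \<inter> Z_ideal h"
proof
  show "Z_ideal (\<lambda>n. min (g n) (h n)) \<subseteq> Z_ideal g \<inter> Z_ideal h"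
    using Z_ideal_mono[of "\<lambda>n. min (g n) (h n)" g] Z_ideal_mono[of "\<lambda>n. min (g n) (h n)" h] assms
    by simp
  show "Z_ideal g \<inter> Z_ideal h \<subseteq> Z_ideal (\<lambda>n. min (g n) (h n))"
  proof
    fix A assume "A \<in> Z_ideal g \<inter> Z_ideal h"
    then have "(\<lambda>n. max (real (card (A \<inter> {..<n})) / g n) (real (card (A \<inter> {..<n})) / h n))
        \<longlonglongrightarrow> max 0 0"
      unfolding Z_ideal_def by (intro tendsto_max) auto
    moreover have "max (c / g n) (c / h n) = c / min (g n) (h n)" if "0 \<le> c" for c n
    proof (cases "g n \<le> h n")
      case True
      then have "c / h n \<le> c / g n" using that assms by (intro divide_left_mono) auto
      then show ?thesis using True by simp
    next
      case False
      then have "c / g n \<le> c / h n" using that assms by (intro divide_left_mono) auto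
      then show ?thesis using False by simp
    qed
    ultimately show "A \<in> Z_ideal (\<lambda>n. min (g n) (h n))" by (simp add: Z_ideal_def)
  qed
qed

text \<open>The ideal grows with the function, so that of \<open>k\<close> is squeezed between two
  equal ones. Divergence of \<open>k\<close> comes from \<open>h\<close>, the remaining condition of
  \<open>G_set\<close> from \<open>g\<close>.\<close>

lemma H_up_same_ideal_between:
  assumes g: "g \<in> H_up_same_ideal f" and h: "h \<in> H_up_same_ideal f"
    and le: "\<And>n. h n \<le> k n" "\<And>n. k n \<le> g n" and k: "mono k" "\<And>n. k n \<in> \<nat>"
  shows "k \<in> H_up_same_ideal f"
proof -
  have H: "g \<in> H_up" "h \<in> H_up" and Z: "Z_ideal f = Z_ideal g" "Z_ideal f = Z_ideal h"
    using g h by (auto simp: H_up_same_ideal_def)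
  have pos: "0 < k n" for n using H_upD(1)[OF H(2)] le(1) order_less_le_trans by blast
  have "filterlim k at_top sequentially"
    using H_upD(2)[OF H(2)] le(1) by (auto intro: filterlim_at_top_mono)
  then have "k \<in> H_up" using H_up_below[OF H(1) pos le(2)] k by blast
  moreover have "Z_ideal h \<subseteq> Z_ideal k" "Z_ideal k \<subseteq> Z_ideal g"
    using Z_ideal_mono H_upD(1)[OF H(2)] pos le by blast+
  ultimately show ?thesis using Z by (auto simp: H_up_same_ideal_def)
qed

section \<open>Monotone envelopes along a sparse sequence\<close>

definition envelope :: "(nat \<Rightarrow> real) \<Rightarrow> (nat \<Rightarrow> real) \<Rightarrow> nat set \<Rightarrow> nat \<Rightarrow> real" where
  "envelope h g T n = Max (insert (h n) (g ` (T \<inter> {..n})))"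

lemma envelope_ge: "h n \<le> envelope h g T n"
  by (simp add: envelope_def)

lemma envelope_le:
  assumes "mono g" "\<And>n. h n \<le> g n"
  shows "envelope h g T n \<le> g n"
  using assms by (auto simp: envelope_def mono_def)

lemma envelope_in:
  assumes "\<And>n. h n \<in> S" "\<And>n. g n \<in> S"
  shows "envelope h g T n \<in> S"
proof -
  have "envelope h g T n \<in> insert (h n) (g ` (T \<inter> {..n}))"
    unfolding envelope_def by (rule Max_in) auto
  then show ?thesis using assms by auto
qed

lemma mono_envelope:
  assumes "mono h"
  shows "mono (envelope h g T)"
proof (rule monoI)
  fix m n :: nat assume mn: "m \<le> n"
  have "h m \<le> envelope h g T n"
    using monoD[OF assms mn] envelope_ge order_trans by blast
  moreover have "g t \<le> envelope h g T n" if "t \<in> T" "t \<le> m" for t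
    unfolding envelope_def using that mn by (intro Max_ge) auto
  ultimately show "envelope h g T m \<le> envelope h g T n"
    unfolding envelope_def[of h g T m] by (intro Max.boundedI) auto
qed

lemma envelope_at:
  assumes "mono g" "\<And>n. h n \<le> g n" "t \<in> T"
  shows "envelope h g T t = g t"
proof (rule antisym[OF envelope_le])
  show "g t \<le> envelope h g T t"
    unfolding envelope_def using assms(3) by (intro Max_ge) auto
qed (use assms in auto)

text \<open>Only points \<open>N j\<close> with \<open>j < i\<close> can contribute, and the gap
  condition bounds their values: \<open>g (N j) \<le> h (N (Suc j)) \<le> h (N i)\<close>.\<close>

lemma envelope_off:
  fixes N :: "nat \<Rightarrow> nat"
  assumes h: "mono h" and N: "strict_mono N" and gap: "\<And>i. g (N i) \<le> h (N (Suc i))"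
    and i: "i \<notin> X"
  shows "envelope h g (N ` X) (N i) = h (N i)"
proof (rule antisym[OF _ envelope_ge])
  have "g (N j) \<le> h (N i)" if "j \<in> X" "N j \<le> N i" for j
  proof -
    have "j \<le> i" using that(2) N by (simp add: strict_mono_less_eq)
    then have "Suc j \<le> i" using that(1) i by (metis Suc_leI le_neq_implies_less)
    then have "h (N (Suc j)) \<le> h (N i)" using h N by (simp add: monoD strict_mono_less_eq)
    then show ?thesis using gap[of j] by linarith
  qed
  then show "envelope h g (N ` X) (N i) \<le> h (N i)"
    unfolding envelope_def by (intro Max.boundedI) auto
qed

lemma sparse_sequence:
  assumes h: "filterlim h at_top sequentially"
    and unb: "\<not> limsup (\<lambda>n. ereal (g n / h n)) < \<infinity>"
  obtains N :: "nat \<Rightarrow> nat" where "strict_mono N" "\<And>i. real i < g (N i) / h (N i)"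
    "\<And>i. g (N i) \<le> h (N (Suc i))"
proof -
  have large: "\<exists>n\<ge>m. C < g n / h n" for C m
    using unb unfolding limsup_ereal_less_top_iff eventually_sequentially by (meson not_le)
  have "\<exists>N. \<forall>i. real i < g (N i) / h (N i) \<and> N i < N (Suc i) \<and> g (N i) \<le> h (N (Suc i))"
  proof (rule dependent_nat_choice)
    show "\<exists>n. real 0 < g n / h n" using large by blast
  next
    fix m i
    obtain M where M: "\<And>n. M \<le> n \<Longrightarrow> g m \<le> h n"
      using h unfolding filterlim_at_top eventually_sequentially by blast
    \<comment> \<open>Beyond \<open>M\<close> the gap condition holds, and starting at
      \<open>Suc m\<close> makes the sequence strictly increasing.\<close>
    obtain n where "max M (Suc m) \<le> n" "real (Suc i) < g n / h n" using large by blast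
    then show "\<exists>n. real (Suc i) < g n / h n \<and> m < n \<and> g m \<le> h n" using M by auto
  qed
  then show ?thesis using that by (metis strict_mono_Suc_iff)
qed

text \<open>For \<open>i\<close> in \<open>X - Y\<close> the quotient at \<open>N i\<close> is
  exactly \<open>g (N i) / h (N i)\<close>, which exceeds \<open>i\<close>, and such
  \<open>i\<close> are arbitrarily large.\<close>

lemma envelope_not_bounded:
  fixes N :: "nat \<Rightarrow> nat"
  assumes g: "mono g" and h: "mono h" and le: "\<And>n. h n \<le> g n"
    and N: "strict_mono N" "\<And>i. real i < g (N i) / h (N i)" "\<And>i. g (N i) \<le> h (N (Suc i))"
    and inf: "infinite (X - Y)"
  shows "\<not> limsup (\<lambda>n. ereal (envelope h g (N ` X) n / envelope h g (N ` Y) n)) < \<infinity>"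
proof
  assume "limsup (\<lambda>n. ereal (envelope h g (N ` X) n / envelope h g (N ` Y) n)) < \<infinity>"
  then obtain C M where CM: "\<And>n. M \<le> n \<Longrightarrow> envelope h g (N ` X) n / envelope h g (N ` Y) n \<le> C"
    unfolding limsup_ereal_less_top_iff eventually_sequentially by blast
  obtain i where i: "i \<in> X" "i \<notin> Y" "max M (nat \<lceil>C\<rceil>) < i"
    using inf unfolding infinite_nat_iff_unbounded by blast
  have "M \<le> N i" using i(3) seq_suble[OF N(1), of i] by linarith
  then have "g (N i) / h (N i) \<le> C"
    using CM[of "N i"] envelope_at[OF g le, of "N i" "N ` X"] envelope_off[OF h N(1,3) i(2)] i(1)
    by simp
  moreover have "C \<le> real i" using i(3) by linarith
  ultimately show False using N(2)[of i] by linarith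
qed

section \<open>The lower bound: continuum many classes\<close>

definition columns :: "nat set \<Rightarrow> nat set" where
  "columns A = {i. fst (prod_decode i) \<in> A}"

text \<open>Under the pairing bijection \<open>columns A\<close> is the product of \<open>A\<close>
  with all naturals, so a single point of \<open>A - B\<close> contributes a whole infinite
  column.\<close>

lemma infinite_columns_diff:
  assumes "a \<in> A" "a \<notin> B"
  shows "infinite (columns A - columns B)"
proof -
  have "range (\<lambda>j. prod_encode (a, j)) \<subseteq> columns A - columns B"
    using assms by (auto simp: columns_def)
  moreover have "infinite (range (\<lambda>j. prod_encode (a, j)))"
    by (intro range_inj_infinite injI) simp
  ultimately show ?thesis using finite_subset by blast
qed

lemma equiv_R_on_same_ideal: "equiv (H_up_same_ideal f) (R_on (H_up_same_ideal f))"
  by (rule equiv_R_on) (auto simp: H_up_same_ideal_def H_up_def)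

lemma nat_sets_lepoll_S_classes:
  assumes g: "g \<in> H_up_same_ideal f" and h: "h \<in> H_up_same_ideal f"
    and le: "\<And>n. h n \<le> g n" and unb: "\<not> limsup (\<lambda>n. ereal (g n / h n)) < \<infinity>"
  shows "(UNIV :: nat set set) \<lesssim> S_classes f"
proof -
  let ?R = "R_on (H_up_same_ideal f)"
  have H: "g \<in> H_up" "h \<in> H_up" using g h by (auto simp: H_up_same_ideal_def)
  obtain N :: "nat \<Rightarrow> nat" where N: "strict_mono N" "\<And>i. real i < g (N i) / h (N i)"
      "\<And>i. g (N i) \<le> h (N (Suc i))"
    using sparse_sequence[OF H_upD(2)[OF H(2)] unb] by blast
  define k where "k A = envelope h g (N ` columns A)" for A
  have k: "k A \<in> H_up_same_ideal f" for A
    unfolding k_def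
    by (intro H_up_same_ideal_between[OF g h] envelope_ge envelope_le mono_envelope envelope_in
        H_upD(4,5)[OF H(1)] H_upD(4,5)[OF H(2)] le)
  \<comment> \<open>A point of \<open>A\<close> outside \<open>B\<close> would make
    \<open>k A / k B\<close> unbounded.\<close>
  have sub: "A \<subseteq> B" if "same_growth (k A) (k B)" for A B
    using that envelope_not_bounded[OF H_upD(4)[OF H(1)] H_upD(4)[OF H(2)] le N]
      infinite_columns_diff unfolding same_growth_def k_def by blast
  have "inj (\<lambda>A. ?R `` {k A})"
  proof (rule injI)
    fix A B assume "?R `` {k A} = ?R `` {k B}"
    then have "(k A, k B) \<in> ?R"
      using eq_equiv_class[OF _ equiv_R_on_same_ideal k] by blast
    then have "same_growth (k A) (k B)" "same_growth (k B) (k A)"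
      by (auto simp: R_on_def same_growth_def)
    then show "A = B" using sub by blast
  qed
  moreover have "range (\<lambda>A. ?R `` {k A}) \<subseteq> S_classes f"
    unfolding S_classes_def using k by (auto intro: quotientI)
  ultimately show ?thesis unfolding lepoll_def by blast
qed

section \<open>The upper bound and the conclusion\<close>

lemma nat_valued_lepoll_nat_sets:
  fixes F :: "(nat \<Rightarrow> real) set"
  assumes "\<And>g n. g \<in> F \<Longrightarrow> g n \<in> \<nat>"
  shows "F \<lesssim> (UNIV :: nat set set)"
proof -
  \<comment> \<open>A function with natural values is determined by its graph, here turned into a
    set of naturals by pairing.\<close>
  define code where "code g = {prod_encode (n, m) | n m. g n = real m}" for g
  have "inj_on code F"
  proof (rule inj_onI, rule ext)
    fix g h n assume gh: "g \<in> F" "h \<in> F" "code g = code h"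
    obtain m where m: "g n = real m" using assms[OF gh(1)] Nats_cases by metis
    then have "prod_encode (n, m) \<in> code h" using gh(3) unfolding code_def by blast
    then show "g n = h n" using m by (auto simp: code_def)
  qed
  then show ?thesis unfolding lepoll_def by blast
qed

lemma S_classes_lepoll_nat_sets: "S_classes f \<lesssim> (UNIV :: nat set set)"
proof -
  have "S_classes f = (\<lambda>g. R_on (H_up_same_ideal f) `` {g}) ` H_up_same_ideal f"
    by (auto simp: S_classes_def quotient_def)
  then have "S_classes f \<lesssim> H_up_same_ideal f" by (metis image_lepoll)
  also have "\<dots> \<lesssim> (UNIV :: nat set set)"
    by (rule nat_valued_lepoll_nat_sets) (auto simp: H_up_same_ideal_def H_up_def)
  finally show ?thesis .
qed

lemma obtain_unbounded_quotient:
  assumes "{..<1::nat} \<prec> S_classes f"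
  obtains g h where "g \<in> H_up_same_ideal f" "h \<in> H_up_same_ideal f"
    "\<not> limsup (\<lambda>n. ereal (g n / h n)) < \<infinity>"
proof -
  let ?X = "H_up_same_ideal f"
  \<comment> \<open>Since \<open>{..<1}\<close> has one element, the assumption says that the
    cardinality exceeds 1.\<close>
  have "\<not> S_classes f \<subseteq> {c}" for c
  proof
    assume "S_classes f \<subseteq> {c}"
    then have "S_classes f \<lesssim> {..<1::nat}"
      using card_mono[of "{c}" "S_classes f"] finite_subset[of "S_classes f" "{c}"]
      by (simp add: lepoll_iff_finite_card)
    then show False using assms lesspoll_def lepoll_antisym by blast
  qed
  then obtain c d where "c \<in> S_classes f" "d \<in> S_classes f" "c \<noteq> d" by blast
  then obtain g h where gh: "g \<in> ?X" "h \<in> ?X" "R_on ?X `` {g} \<noteq> R_on ?X `` {h}"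
    unfolding S_classes_def by (auto elim!: quotientE)
  then have "(g, h) \<notin> R_on ?X" using equiv_class_eq[OF equiv_R_on_same_ideal] by blast
  with gh(1,2) have "\<not> same_growth g h" by (simp add: R_on_def)
  \<comment> \<open>Inequivalence makes one of the two quotients unbounded; if it is
    \<open>h / g\<close>, the two functions swap roles.\<close>
  then show ?thesis using that gh(1,2) unfolding same_growth_def by blast
qed

theorem proposition5:
  fixes f :: "nat \<Rightarrow> real"
  assumes "f \<in> H_up"
    and "{..<1::nat} \<prec> S_classes f"
  shows "S_classes f \<approx> (UNIV :: real set)"
proof -
  obtain g h where g: "g \<in> H_up_same_ideal f" and h: "h \<in> H_up_same_ideal f"
    and unb: "\<not> limsup (\<lambda>n. ereal (g n / h n)) < \<infinity>"
    using obtain_unbounded_quotient[OF assms(2)] .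
  have H: "g \<in> H_up" "h \<in> H_up" and Z: "Z_ideal f = Z_ideal g" "Z_ideal f = Z_ideal h"
    using g h by (auto simp: H_up_same_ideal_def)
  let ?m = "\<lambda>n. min (g n) (h n)"
  have m: "?m \<in> H_up_same_ideal f"
    using H_up_min[OF H] Z_ideal_min[of g h] H_upD(1)[OF H(1)] H_upD(1)[OF H(2)] Z
    by (simp add: H_up_same_ideal_def)
  have "\<not> limsup (\<lambda>n. ereal (g n / ?m n)) < \<infinity>"
  proof
    assume "limsup (\<lambda>n. ereal (g n / ?m n)) < \<infinity>"
    then obtain C where "\<forall>\<^sub>F n in sequentially. g n / ?m n \<le> C"
      unfolding limsup_ereal_less_top_iff by blast
    \<comment> \<open>Replacing \<open>h\<close> by the minimum only enlarges the quotient, so it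
      stays unbounded.\<close>
    moreover have "g n / h n \<le> g n / ?m n" for n
      using H_upD(1)[OF H(1), of n] H_upD(1)[OF H(2), of n] by (intro divide_left_mono) auto
    ultimately have "\<forall>\<^sub>F n in sequentially. g n / h n \<le> C"
      by (auto elim!: eventually_mono intro: order_trans)
    then show False using unb unfolding limsup_ereal_less_top_iff by blast
  qed
  then have "(UNIV :: nat set set) \<lesssim> S_classes f"
    by (intro nat_sets_lepoll_S_classes[OF g m]) auto
  then have "S_classes f \<approx> (UNIV :: nat set set)"
    using S_classes_lepoll_nat_sets lepoll_antisym by blast
  then show ?thesis using nat_sets_eqpoll_reals eqpoll_trans by blast
qed

end
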